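(* Let $X$ be a topological space that is Hausdorff or quasiregular. Then $d(X)\leq\pi\chi(X)^{c(X)\cdot nq(X)}$.
   Context: No separation axioms are assumed unless stated. Cardinal functions follow Juhász's conventions; in particular $\pi\chi(X)$ and $c(X)$ are by convention infinite cardinals. A space $X$ is quasiregular if every nonempty open set $U$ of $X$ contains a nonempty open set $V$ such that $\overline{V}\subseteq U$. The density $d(X)$ is the least cardinality of a dense subset of $X$. A local $\pi$-base at $x\in X$ is a family $\mathcal{B}$ of nonempty open subsets of $X$ such that every open set containing $x$ contains a member of $\mathcal{B}$. The $\pi$-character $\pi\chi(X)$ is the least infinite cardinal $\lambda$ such that every $x\in X$ has a local $\pi$-base of cardinality at most $\lambda$. The cellularity $c(X)$ is the least infinite cardinal $\kappa$ such that every family of pairwise disjoint nonempty open subsets of $X$ has cardinality at most $\kappa$. The nonquasiregularity degree $nq(X)$ is the least infinite cardinal $\kappa$ such that for every nonempty open set $U\subseteq X$ there is a family $\mathcal{V}$ of open subsets of $X$ with $|\mathcal{V}|\leq\kappa$, such that $G=\bigcap\mathcal{V}$ is a nonempty subset of $U$ and $\bigcap_{V\in\mathcal{V}}\overline{V}\subseteq U$. Such a $\kappa$ exists whenever $X$ is Hausdorff or quasiregular. *)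

theory Defs
  imports "HOL-Analysis.Analysis"
begin

unbundle cardinal_syntax

definition quasiregular_space :: "'a topology \<Rightarrow> bool" where
  "quasiregular_space X \<longleftrightarrow>
     (\<forall>U. openin X U \<and> U \<noteq> {} \<longrightarrow>
        (\<exists>V. openin X V \<and> V \<noteq> {} \<and> X closure_of V \<subseteq> U))"

definition dense_subset :: "'a topology \<Rightarrow> 'a set \<Rightarrow> bool" where
  "dense_subset X D \<longleftrightarrow> D \<subseteq> topspace X \<and> X closure_of D = topspace X"

definition local_pi_base :: "'a topology \<Rightarrow> 'a \<Rightarrow> 'a set set \<Rightarrow> bool" where
  "local_pi_base X x \<B> \<longleftrightarrow>
     (\<forall>B\<in>\<B>. openin X B \<and> B \<noteq> {}) \<and>
     (\<forall>U. openin X U \<and> x \<in> U \<longrightarrow> (\<exists>B\<in>\<B>. B \<subseteq> U))"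

text \<open>
  Cardinals are represented, up to the isomorphism \<open>=o\<close>, by cardinal orders on a type.  The
  cardinal functions that are infinite by convention take their values on the type \<open>'a set + nat\<close>:
  it carries every cardinal up to \<open>max (2^|'a|) \<aleph>\<^sub>0\<close>, which bounds the cardinality of every family
  of subsets of the space, and the summand \<open>nat\<close> supplies \<open>\<aleph>\<^sub>0\<close> when \<open>'a\<close> is finite.
  Since cardinals below a given one are again carried by the same type, a least cardinal
  among those on this type is least among all cardinals.
\<close>

definition least_infinite_cardinal :: "('b rel \<Rightarrow> bool) \<Rightarrow> 'b rel" where
  "least_infinite_cardinal P =
     (SOME \<kappa>. Cinfinite \<kappa> \<and> P \<kappa> \<and> (\<forall>\<mu>. Cinfinite \<mu> \<and> P \<mu> \<longrightarrow> \<kappa> \<le>o \<mu>))"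

text \<open>The density is not forced to be infinite.\<close>

definition topological_density :: "'a topology \<Rightarrow> 'a rel" where
  "topological_density X =
     |SOME D. dense_subset X D \<and> (\<forall>E. dense_subset X E \<longrightarrow> |D| \<le>o |E| )|"

definition pi_character :: "'a topology \<Rightarrow> ('a set + nat) rel" where
  "pi_character X =
     least_infinite_cardinal (\<lambda>\<mu>. \<forall>x\<in>topspace X. \<exists>\<B>. local_pi_base X x \<B> \<and> |\<B>| \<le>o \<mu>)"

definition cellularity :: "'a topology \<Rightarrow> ('a set + nat) rel" where
  "cellularity X =
     least_infinite_cardinal (\<lambda>\<kappa>. \<forall>\<U>. (\<forall>U\<in>\<U>. openin X U \<and> U \<noteq> {}) \<and> pairwise disjnt \<U> \<longrightarrow> |\<U>| \<le>o \<kappa>)"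

text \<open>
  Intersections are taken inside the space, so that the empty family has intersection
  \<open>topspace X\<close> rather than \<open>UNIV\<close>.
\<close>

definition nonquasiregularity_degree :: "'a topology \<Rightarrow> ('a set + nat) rel" where
  "nonquasiregularity_degree X =
     least_infinite_cardinal (\<lambda>\<kappa>. \<forall>U. openin X U \<and> U \<noteq> {} \<longrightarrow>
       (\<exists>\<V>. (\<forall>V\<in>\<V>. openin X V) \<and> |\<V>| \<le>o \<kappa> \<and>
          topspace X \<inter> \<Inter>\<V> \<noteq> {} \<and>
          topspace X \<inter> \<Inter>\<V> \<subseteq> U \<and>
          topspace X \<inter> (\<Inter>V\<in>\<V>. X closure_of V) \<subseteq> U))"

text \<open>The minima above are attained, so the choice operators return the intended cardinals.\<close>

lemma least_infinite_cardinal: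
  assumes "Cinfinite \<nu>" "P \<nu>"
  shows "Cinfinite (least_infinite_cardinal P)"
    and "P (least_infinite_cardinal P)"
    and "\<And>\<mu>. Cinfinite \<mu> \<Longrightarrow> P \<mu> \<Longrightarrow> least_infinite_cardinal P \<le>o \<mu>"
proof -
  have "\<exists>\<kappa>\<in>{\<kappa>. Cinfinite \<kappa> \<and> P \<kappa>}. \<forall>\<mu>\<in>{\<kappa>. Cinfinite \<kappa> \<and> P \<kappa>}. \<kappa> \<le>o \<mu>"
    by (rule exists_minim_Card_order) (use assms in blast)+
  then have ex: "\<exists>\<kappa>. Cinfinite \<kappa> \<and> P \<kappa> \<and> (\<forall>\<mu>. Cinfinite \<mu> \<and> P \<mu> \<longrightarrow> \<kappa> \<le>o \<mu>)"
    by blast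
  note * = someI_ex[OF ex, folded least_infinite_cardinal_def]
  show "Cinfinite (least_infinite_cardinal P)" "P (least_infinite_cardinal P)"
    "\<And>\<mu>. Cinfinite \<mu> \<Longrightarrow> P \<mu> \<Longrightarrow> least_infinite_cardinal P \<le>o \<mu>"
    using * by blast+
qed

lemma Cinfinite_universe: "Cinfinite |UNIV :: ('a set + nat) set|"
  using card_of_Card_order by (simp only: cinfinite_def Field_card_of finite_Plus_UNIV_iff) simp

lemma card_of_family_le: "|\<F> :: 'a set set| \<le>o |UNIV :: ('a set + nat) set|"
  by (rule card_of_ordLeqI[where f = Inl]) auto

lemma topological_density_attained:
  "\<exists>D. dense_subset X D \<and> topological_density X = |D| \<and> (\<forall>E. dense_subset X E \<longrightarrow> |D| \<le>o |E| )"
proof -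
  have "\<exists>r\<in>{|D| |D. dense_subset X D}. \<forall>r'\<in>{|D| |D. dense_subset X D}. r \<le>o r'"
  proof (rule exists_minim_Card_order)
    have "dense_subset X (topspace X)"
      by (simp add: dense_subset_def)
    then show "{|D| |D. dense_subset X D} \<noteq> {}"
      by blast
    show "\<forall>r\<in>{|D| |D. dense_subset X D}. Card_order r"
      using card_of_Card_order by blast
  qed
  then have "\<exists>D. dense_subset X D \<and> (\<forall>E. dense_subset X E \<longrightarrow> |D| \<le>o |E| )"
    by blast
  from someI_ex[OF this] show ?thesis
    unfolding topological_density_def by blast
qed

lemma pi_character_exists:
  "\<forall>x\<in>topspace X. \<exists>\<B>. local_pi_base X x \<B> \<and> |\<B>| \<le>o |UNIV :: ('a set + nat) set|"
  for X :: "'a topology"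
proof
  fix x assume "x \<in> topspace X"
  have "local_pi_base X x {B. openin X B \<and> B \<noteq> {}}"
    unfolding local_pi_base_def by auto
  then show "\<exists>\<B>. local_pi_base X x \<B> \<and> |\<B>| \<le>o |UNIV :: ('a set + nat) set|"
    using card_of_family_le by (intro exI conjI)
qed

lemma nonquasiregularity_degree_exists:
  fixes X :: "'a topology"
  assumes "Hausdorff_space X \<or> quasiregular_space X"
  shows "\<forall>U. openin X U \<and> U \<noteq> {} \<longrightarrow>
    (\<exists>\<V>. (\<forall>V\<in>\<V>. openin X V) \<and> |\<V>| \<le>o |UNIV :: ('a set + nat) set| \<and>
       topspace X \<inter> \<Inter>\<V> \<noteq> {} \<and> topspace X \<inter> \<Inter>\<V> \<subseteq> U \<and>
       topspace X \<inter> (\<Inter>V\<in>\<V>. X closure_of V) \<subseteq> U)"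
proof (intro allI impI)
  fix U assume U: "openin X U \<and> U \<noteq> {}"
  have "\<exists>\<V>. (\<forall>V\<in>\<V>. openin X V) \<and> topspace X \<inter> \<Inter>\<V> \<noteq> {} \<and>
      topspace X \<inter> (\<Inter>V\<in>\<V>. X closure_of V) \<subseteq> U"
    using assms
  proof
    assume H: "Hausdorff_space X"
    from U obtain x where x: "x \<in> U" "x \<in> topspace X"
      using openin_subset by blast
    have "y = x" if y: "y \<in> topspace X" "\<And>V. openin X V \<Longrightarrow> x \<in> V \<Longrightarrow> y \<in> X closure_of V" for y
    proof (rule ccontr)
      assume "y \<noteq> x"
      then obtain V W where "openin X V" "openin X W" "x \<in> V" "y \<in> W" "disjnt V W"
        using H x y(1) unfolding Hausdorff_space_def by metis
      then show False
        using y(2)[of V] unfolding in_closure_of disjnt_def by blast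
    qed
    then show ?thesis
      using x by (intro exI[of _ "{V. openin X V \<and> x \<in> V}"]) auto
  next
    assume "quasiregular_space X"
    then obtain V where "openin X V" "V \<noteq> {}" "X closure_of V \<subseteq> U"
      using U unfolding quasiregular_space_def by blast
    then show ?thesis
      using openin_subset by (intro exI[of _ "{V}"]) fastforce
  qed
  then obtain \<V> where \<V>: "\<forall>V\<in>\<V>. openin X V" "topspace X \<inter> \<Inter>\<V> \<noteq> {}"
    "topspace X \<inter> (\<Inter>V\<in>\<V>. X closure_of V) \<subseteq> U"
    by blast
  have "\<Inter>\<V> \<inter> topspace X \<subseteq> (\<Inter>V\<in>\<V>. X closure_of V)"
    using \<V>(1) by (auto intro!: subsetD[OF closure_of_subset] dest: openin_subset)
  then have "topspace X \<inter> \<Inter>\<V> \<subseteq> U"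
    using \<V>(3) by blast
  then show "\<exists>\<V>. (\<forall>V\<in>\<V>. openin X V) \<and> |\<V>| \<le>o |UNIV :: ('a set + nat) set| \<and>
       topspace X \<inter> \<Inter>\<V> \<noteq> {} \<and> topspace X \<inter> \<Inter>\<V> \<subseteq> U \<and>
       topspace X \<inter> (\<Inter>V\<in>\<V>. X closure_of V) \<subseteq> U"
    by (intro exI[of _ \<V>] conjI card_of_family_le \<V>)
qed

end

theory Submission
  imports Defs
begin

text \<open>
  Put \<open>\<kappa> = c(X) nq(X)\<close> and \<open>\<mu> = \<pi>\<chi>(X)\<^sup>\<kappa>\<close>, so that \<open>\<mu>\<^sup>\<kappa> = \<mu>\<close>, and fix a local \<open>\<pi>\<close>-base of size at
  most \<open>\<pi>\<chi>(X)\<close> at each point.  Closing off in \<open>\<kappa>\<^sup>+\<close> steps gives a family \<open>A\<close> of at most \<open>\<mu>\<close> sets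
  such that, whenever at most \<open>\<kappa>\<close> subfamilies \<open>\<W>\<close> of \<open>A\<close> of size at most \<open>\<kappa>\<close> are given and the
  closures of their unions do not cover \<open>X\<close>, some uncovered point has its \<open>\<pi>\<close>-base inside \<open>A\<close>.
  The points with \<open>\<pi>\<close>-base inside \<open>A\<close> are dense: if a nonempty open \<open>U\<close> missed them, take \<open>\<V>\<close>
  for \<open>U\<close> as in the definition of \<open>nq(X)\<close> and, for each \<open>V \<in> \<V>\<close>, a maximal disjoint family of
  members of \<open>A\<close> that miss the closure of \<open>V\<close>.  The closure of the union of this family misses \<open>V\<close>
  and contains every point with \<open>\<pi>\<close>-base inside \<open>A\<close> that lies outside the closure of \<open>V\<close>.  As
  \<open>\<Inter>\<V>\<close> stays uncovered, there is an uncovered point with \<open>\<pi>\<close>-base inside \<open>A\<close>; it lies outside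
  \<open>U\<close>, hence outside the closure of some \<open>V\<close>, hence is covered after all.
\<close>

section \<open>Closing off under an operation on small subsets\<close>

text \<open>Every nonempty subset counted here is the image of a function from
  \<open>Field \<kappa>\<close> to \<open>B\<close>, and there are at most
  \<open>\<mu> ^c \<kappa>\<close> such functions; the empty set is added by hand.\<close>

lemma card_of_bounded_subsets:
  fixes B :: "'a set"
  assumes "Cinfinite \<mu>" "\<mu> ^c \<kappa> \<le>o \<mu>" "|B| \<le>o \<mu>" "Card_order \<kappa>"
  shows "|{S. S \<subseteq> B \<and> |S| \<le>o \<kappa>}| \<le>o \<mu>"
proof -
  have inf: "\<not> finite (Field \<mu>)" and co: "Card_order \<mu>"
    using assms(1) by (auto simp: cinfinite_def)
  have "|Func (Field \<kappa>) B| \<le>o \<mu> ^c \<kappa>"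
  proof -
    have "|Func (Field \<kappa>) B| =o |B| ^c \<kappa>"
      by (simp add: cexp_def Field_card_of card_of_refl)
    also have "|B| ^c \<kappa> \<le>o \<mu> ^c \<kappa>"
      by (rule cexp_mono1[OF assms(3,4)])
    finally show ?thesis .
  qed
  then have "|(\<lambda>f. f ` Field \<kappa>) ` Func (Field \<kappa>) B| \<le>o \<mu>"
    by (rule ordLeq_transitive[OF card_of_image ordLeq_transitive[OF _ assms(2)]])
  moreover have "|{{}} :: 'a set set| \<le>o \<mu>"
    using assms(1) by (intro ordLess_imp_ordLeq Cfinite_ordLess_Cinfinite)
      (simp_all add: cfinite_def card_of_card_order_on Field_card_of)
  ultimately have "|(\<lambda>f. f ` Field \<kappa>) ` Func (Field \<kappa>) B \<union> {{}}| \<le>o \<mu>"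
    by (intro card_of_Un_ordLeq_infinite_Field inf co)
  moreover have "{S. S \<subseteq> B \<and> |S| \<le>o \<kappa>} \<subseteq> (\<lambda>f. f ` Field \<kappa>) ` Func (Field \<kappa>) B \<union> {{}}"
  proof
    fix S assume S: "S \<in> {S. S \<subseteq> B \<and> |S| \<le>o \<kappa>}"
    show "S \<in> (\<lambda>f. f ` Field \<kappa>) ` Func (Field \<kappa>) B \<union> {{}}"
    proof (cases "S = {}")
      case False
      have "|S| \<le>o |Field \<kappa>|"
        by (rule ordLeq_ordIso_trans[OF _ ordIso_symmetric[OF card_of_Field_ordIso[OF assms(4)]]])
          (use S in simp)
      then obtain g where g: "g ` Field \<kappa> = S"
        using card_of_ordLeq2[OF False, of "Field \<kappa>"] by auto
      let ?f = "\<lambda>x. if x \<in> Field \<kappa> then g x else undefined"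
      have "?f \<in> Func (Field \<kappa>) B" "?f ` Field \<kappa> = S"
        using g S by (auto simp: Func_def)
      then show ?thesis by blast
    qed simp
  qed
  ultimately show ?thesis
    using ordLeq_transitive[OF card_of_mono1] by fast
qed

text \<open>Stage \<open>i\<close> of a recursion along the successor of \<kappa> collects
  \<open>F S\<close> for all small \<open>S\<close> inside the union of the earlier stages. The
  assumption \<open>\<mu> ^c \<kappa> \<le>o \<mu>\<close> keeps each stage of size at most \<mu>,
  and regularity of the successor puts any small subset of the union inside a single stage.\<close>

lemma exists_closed_set:
  fixes F :: "'a set \<Rightarrow> 'a set" and \<kappa> :: "'k rel"
  assumes \<kappa>: "Cinfinite \<kappa>" and \<mu>: "Cinfinite \<mu>" "\<mu> ^c \<kappa> \<le>o \<mu>"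
    and F: "\<And>S. |S| \<le>o \<kappa> \<Longrightarrow> |F S| \<le>o \<mu>"
  obtains A where "|A| \<le>o \<mu>" "\<And>S. S \<subseteq> A \<Longrightarrow> |S| \<le>o \<kappa> \<Longrightarrow> F S \<subseteq> A"
proof -
  have inf: "\<not> finite (Field \<mu>)" and co: "Card_order \<mu>" and co\<kappa>: "Card_order \<kappa>"
    using \<mu>(1) \<kappa> by (auto simp: cinfinite_def)
  define r where "r = cardSuc \<kappa>"
  have r: "Cinfinite r" "Card_order r"
    using \<kappa> by (auto simp: r_def Cinfinite_cardSuc cardSuc_Card_order)
  interpret wo: wo_rel r
    using r(2) unfolding wo_rel_def card_order_on_def by blast
  \<comment> \<open>Since \<kappa> is below its power set, which is at most
    \<open>\<mu> ^c \<kappa>\<close>, its successor is at most \<mu>: there are at most \<mu>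
    stages.\<close>
  have "ctwo \<le>o \<mu>"
    by (rule ctwo_ordLeq_Cinfinite[OF \<mu>(1)])
  then have "ctwo ^c \<kappa> \<le>o \<mu> ^c \<kappa>"
    by (rule cexp_mono1[OF _ co\<kappa>])
  then have "\<kappa> <o \<mu>"
    by (rule ordLess_ordLeq_trans[OF ordLess_ctwo_cexp[OF co\<kappa>] ordLeq_transitive[OF _ \<mu>(2)]])
  then have r\<mu>: "r \<le>o \<mu>"
    unfolding r_def by (rule cardSuc_least[OF co\<kappa> co])
  then have Fr: "|Field r| \<le>o \<mu>"
    by (rule ordIso_ordLeq_trans[OF card_of_Field_ordIso[OF r(2)]])
  define H where "H = (\<lambda>f i. \<Union>(F ` {S. S \<subseteq> \<Union>(f ` underS r i) \<and> |S| \<le>o \<kappa>}))"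
  define As where "As = wfrec (r - Id) H"
  have As: "As i = \<Union>(F ` {S. S \<subseteq> \<Union>(As ` underS r i) \<and> |S| \<le>o \<kappa>})" for i
  proof -
    have "As i = H (cut As (r - Id) i) i"
      unfolding As_def by (rule wfrec[OF wo.WF])
    moreover have "cut As (r - Id) i ` underS r i = As ` underS r i"
      by (rule image_cong) (auto simp: cut_def underS_def)
    ultimately show ?thesis
      by (simp add: H_def)
  qed
  have card: "|As i| \<le>o \<mu>" if "i \<in> Field r" for i
    using that
  proof (induction i rule: wf_induct_rule[OF wo.WF])
    case (1 i)
    have "|underS r i| \<le>o \<mu>"
      by (rule ordLess_imp_ordLeq[OF ordLess_ordLeq_trans[OF card_of_underS[OF r(2) 1(2)] r\<mu>]])
    moreover have "\<forall>j\<in>underS r i. |As j| \<le>o \<mu>"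
      using 1(1) by (auto simp: underS_def Field_def)
    ultimately have "|\<Union>(As ` underS r i)| \<le>o \<mu>"
      by (intro card_of_UNION_ordLeq_infinite_Field inf co)
    then have "|{S. S \<subseteq> \<Union>(As ` underS r i) \<and> |S| \<le>o \<kappa>}| \<le>o \<mu>"
      by (intro card_of_bounded_subsets \<mu> co\<kappa>)
    then show ?case
      unfolding As[of i] using F by (intro card_of_UNION_ordLeq_infinite_Field inf co) auto
  qed
  have chain: "relChain r As"
    unfolding relChain_def
  proof (intro allI impI)
    fix i j assume "(i, j) \<in> r"
    then have "underS r i \<subseteq> underS r j"
      by (rule underS_incr[OF wo.TRANS wo.ANTISYM])
    then have sub: "\<Union>(As ` underS r i) \<subseteq> \<Union>(As ` underS r j)"
      by (intro Union_mono image_mono)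
    show "As i \<subseteq> As j"
      unfolding As[of i] As[of j]
      by (intro Union_mono image_mono Collect_mono impI) (metis sub subset_trans)
  qed
  show thesis
  proof
    show "|\<Union>i\<in>Field r. As i| \<le>o \<mu>"
      using Fr card by (intro card_of_UNION_ordLeq_infinite_Field inf co) auto
    fix S assume S: "S \<subseteq> (\<Union>i\<in>Field r. As i)" "|S| \<le>o \<kappa>"
    obtain i where i: "i \<in> Field r" "S \<subseteq> As i"
      using cardSuc_UNION_Cinfinite[OF \<kappa> chain[unfolded r_def] S(1)[unfolded r_def] S(2), folded r_def]
      by blast
    \<comment> \<open>A stage only sees strictly earlier ones, so \<open>F S\<close> is caught
      beyond \<open>i\<close>; an infinite cardinal has no last element.\<close>
    obtain j where j: "j \<in> Field r" "i \<noteq> j" "(i, j) \<in> r"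
      using Cinfinite_limit[OF i(1) r(1)] by blast
    then have "S \<subseteq> \<Union>(As ` underS r j)"
      using i(2) by (auto simp: underS_def)
    then have "F S \<subseteq> As j"
      unfolding As[of j] using S(2) by blast
    then show "F S \<subseteq> (\<Union>i\<in>Field r. As i)"
      using j(1) by blast
  qed
qed

text \<open>Zorn's lemma gives a maximal \<open>\<M>\<close>. A \<open>B\<close> disjoint from all
  of \<open>\<M>\<close> could be added, so it already lies in \<open>\<M>\<close> and is disjoint
  from itself, hence empty.\<close>

lemma maximal_disjoint_subfamily:
  assumes "{} \<notin> \<F>"
  shows "\<exists>\<M>. \<M> \<subseteq> \<F> \<and> pairwise disjnt \<M> \<and> (\<forall>B\<in>\<F>. \<exists>M\<in>\<M>. \<not> disjnt B M)"
proof -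
  let ?P = "{\<M>. \<M> \<subseteq> \<F> \<and> pairwise disjnt \<M>}"
  have "\<exists>M\<in>?P. \<forall>N\<in>?P. M \<subseteq> N \<longrightarrow> N = M"
  proof (rule subset_Zorn_nonempty)
    have "{} \<in> ?P"
      by simp
    then show "?P \<noteq> {}"
      by (metis empty_iff)
    fix \<C> assume C: "subset.chain ?P \<C>"
    then have "chain\<^sub>\<subseteq> \<C>" "\<C> \<subseteq> ?P"
      by (simp_all add: subset_chain_def chain_subset_def)
    then show "\<Union>\<C> \<in> ?P"
      using pairwise_chain_Union[of \<C> disjnt] by fastforce
  qed
  then obtain \<M> where M: "\<M> \<in> ?P" and max: "\<forall>N\<in>?P. \<M> \<subseteq> N \<longrightarrow> N = \<M>"
    by (rule bexE)
  have "\<exists>M\<in>\<M>. \<not> disjnt B M" if B: "B \<in> \<F>" for B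
  proof (rule ccontr)
    assume none: "\<not> ?thesis"
    then have "insert B \<M> \<in> ?P"
      using M B by (simp add: pairwise_insert disjnt_sym)
    then have "insert B \<M> = \<M>"
      using max by (metis subset_insertI)
    then have "disjnt B B"
      using none by (metis insertI1)
    then show False
      using B assms by simp
  qed
  then show ?thesis
    using M by (intro exI[of _ \<M>]) simp
qed

section \<open>The cardinal functions as attained minima\<close>

lemma Cinfinite_pi_character: "Cinfinite (pi_character X)"
  unfolding pi_character_def
  by (rule least_infinite_cardinal(1)[OF Cinfinite_universe]) (rule pi_character_exists)

lemma local_pi_base_pi_character:
  assumes "x \<in> topspace X"
  obtains \<B> where "local_pi_base X x \<B>" "|\<B>| \<le>o pi_character X"
  using least_infinite_cardinal(2)[OF Cinfinite_universe, where P =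
      "\<lambda>\<mu>. \<forall>x\<in>topspace X. \<exists>\<B>. local_pi_base X x \<B> \<and> |\<B>| \<le>o \<mu>",
      OF pi_character_exists, folded pi_character_def] assms
  by blast

lemma Cinfinite_cellularity: "Cinfinite (cellularity X)"
  unfolding cellularity_def
  by (rule least_infinite_cardinal(1)[OF Cinfinite_universe]) (intro allI impI card_of_family_le)

lemma card_of_disjoint_family_le_cellularity:
  assumes "\<And>U. U \<in> \<U> \<Longrightarrow> openin X U" "\<And>U. U \<in> \<U> \<Longrightarrow> U \<noteq> {}" "pairwise disjnt \<U>"
  shows "|\<U>| \<le>o cellularity X"
proof -
  have "\<forall>\<U>. (\<forall>U\<in>\<U>. openin X U \<and> U \<noteq> {}) \<and> pairwise disjnt \<U> \<longrightarrow> |\<U>| \<le>o cellularity X"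
    unfolding cellularity_def
    by (rule least_infinite_cardinal(2)[OF Cinfinite_universe, where P =
      "\<lambda>\<kappa>. \<forall>\<U>. (\<forall>U\<in>\<U>. openin X U \<and> U \<noteq> {}) \<and> pairwise disjnt \<U> \<longrightarrow> |\<U>| \<le>o \<kappa>"])
     (intro allI impI card_of_family_le)
  then show ?thesis
    using assms by blast
qed

lemma Cinfinite_nonquasiregularity_degree:
  assumes "Hausdorff_space X \<or> quasiregular_space X"
  shows "Cinfinite (nonquasiregularity_degree X)"
  unfolding nonquasiregularity_degree_def
  by (rule least_infinite_cardinal(1)[OF Cinfinite_universe])
    (rule nonquasiregularity_degree_exists[OF assms])

lemma nonquasiregularity_degree_family:
  assumes "Hausdorff_space X \<or> quasiregular_space X" "openin X U" "U \<noteq> {}"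
  obtains \<V> where "\<And>V. V \<in> \<V> \<Longrightarrow> openin X V" "|\<V>| \<le>o nonquasiregularity_degree X"
    "topspace X \<inter> \<Inter>\<V> \<noteq> {}" "topspace X \<inter> \<Inter>\<V> \<subseteq> U"
    "topspace X \<inter> (\<Inter>V\<in>\<V>. X closure_of V) \<subseteq> U"
proof -
  have "\<forall>U. openin X U \<and> U \<noteq> {} \<longrightarrow>
       (\<exists>\<V>. (\<forall>V\<in>\<V>. openin X V) \<and> |\<V>| \<le>o nonquasiregularity_degree X \<and>
          topspace X \<inter> \<Inter>\<V> \<noteq> {} \<and> topspace X \<inter> \<Inter>\<V> \<subseteq> U \<and>
          topspace X \<inter> (\<Inter>V\<in>\<V>. X closure_of V) \<subseteq> U)"
    unfolding nonquasiregularity_degree_def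
    by (rule least_infinite_cardinal(2)[OF Cinfinite_universe, where P =
      "\<lambda>\<kappa>. \<forall>U. openin X U \<and> U \<noteq> {} \<longrightarrow>
       (\<exists>\<V>. (\<forall>V\<in>\<V>. openin X V) \<and> |\<V>| \<le>o \<kappa> \<and>
          topspace X \<inter> \<Inter>\<V> \<noteq> {} \<and> topspace X \<inter> \<Inter>\<V> \<subseteq> U \<and>
          topspace X \<inter> (\<Inter>V\<in>\<V>. X closure_of V) \<subseteq> U)"])
     (rule nonquasiregularity_degree_exists[OF assms(1)])
  then show thesis
    using assms(2,3) that by meson
qed

lemma topological_density_le:
  assumes "dense_subset X D"
  shows "topological_density X \<le>o |D|"
  using topological_density_attained[of X] assms by auto

section \<open>The bound on the density\<close>

theorem corollary2p7:
  fixes X :: "'a topology"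
  assumes "Hausdorff_space X \<or> quasiregular_space X"
  shows "topological_density X \<le>o pi_character X ^c (cellularity X *c nonquasiregularity_degree X)"
proof -
  let ?c = "cellularity X" and ?n = "nonquasiregularity_degree X"
  define \<kappa> where "\<kappa> = ?c *c ?n"
  define \<mu> where "\<mu> = pi_character X ^c \<kappa>"
  note ci = Cinfinite_pi_character[of X] Cinfinite_cellularity[of X]
    Cinfinite_nonquasiregularity_degree[OF assms]
  have \<kappa>: "Cinfinite \<kappa>"
    unfolding \<kappa>_def by (rule Cinfinite_cprod2[OF Cinfinite_Cnotzero[OF ci(2)] ci(3)])
  have c\<kappa>: "?c \<le>o \<kappa>"
    unfolding \<kappa>_def by (rule ordLeq_transitive[OF ordLeq_cprod2[OF Cinfinite_Cnotzero[OF ci(3)]]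
        ordIso_imp_ordLeq[OF cprod_com]]) (use ci in simp)
  have n\<kappa>: "?n \<le>o \<kappa>"
    unfolding \<kappa>_def using ci by (intro ordLeq_cprod2 Cinfinite_Cnotzero) auto
  have two: "ctwo \<le>o pi_character X"
    by (rule ctwo_ordLeq_Cinfinite[OF ci(1)])
  have \<mu>: "Cinfinite \<mu>"
    unfolding \<mu>_def by (rule Cinfinite_cexp[OF two \<kappa>])
  then have inf: "\<not> finite (Field \<mu>)" and co: "Card_order \<mu>"
    by (simp_all add: cinfinite_def)
  have co\<kappa>: "Card_order \<kappa>" and inf\<kappa>: "\<not> finite (Field \<kappa>)"
    using \<kappa> by (simp_all add: cinfinite_def)
  have \<mu>\<kappa>: "\<mu> ^c \<kappa> \<le>o \<mu>"
    unfolding \<mu>_def using ci(1)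
    by (intro ordIso_imp_ordLeq cexp_cprod_ordLeq \<kappa> Cinfinite_Cnotzero ordLeq_refl[OF co\<kappa>]) simp
  have pi\<mu>: "pi_character X \<le>o \<mu>"
    unfolding \<mu>_def using ci(1) \<kappa> by (intro ordLeq_cexp1 Cinfinite_Cnotzero) auto
  have two\<mu>: "ctwo ^c \<kappa> \<le>o \<mu>"
    unfolding \<mu>_def by (rule cexp_mono1[OF two co\<kappa>])
  have "\<forall>x. \<exists>\<B>. x \<in> topspace X \<longrightarrow> local_pi_base X x \<B> \<and> |\<B>| \<le>o \<mu>"
    using local_pi_base_pi_character ordLeq_transitive[OF _ pi\<mu>] by metis
  then obtain \<B> where \<B>: "\<And>x. x \<in> topspace X \<Longrightarrow> local_pi_base X x (\<B> x)"
    "\<And>x. x \<in> topspace X \<Longrightarrow> |\<B> x| \<le>o \<mu>"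
    by metis
  \<comment> \<open>\<open>R \<S>\<close> is the uncovered part and \<open>p \<S>\<close> a chosen
    point of it. Closure under \<open>F\<close> forces the local \<pi>-bases of these points into
    \<open>A\<close>.\<close>
  define R where "R \<S> = topspace X - (\<Union>\<W>\<in>\<S>. X closure_of \<Union>\<W>)" for \<S>
  define p where "p \<S> = (SOME x. x \<in> R \<S>)" for \<S>
  have p: "p \<S> \<in> R \<S>" if "R \<S> \<noteq> {}" for \<S>
    using that unfolding p_def by (simp add: some_in_eq)
  define F where "F S = (\<Union>\<S>\<in>{\<S>. \<S> \<subseteq> Pow S \<and> |\<S>| \<le>o \<kappa> \<and> R \<S> \<noteq> {}}. \<B> (p \<S>))" for S
  have F: "|F S| \<le>o \<mu>" if S: "|S| \<le>o \<kappa>" for S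
  proof -
    \<comment> \<open>Small subsets are counted twice: first those of \<open>S\<close>, which are
      all its subsets, then those of \<open>Pow S\<close>.\<close>
    have "|Pow S| \<le>o |{T. T \<subseteq> S \<and> |T| \<le>o \<kappa>}|"
      using S ordLeq_transitive[OF card_of_mono1] by (intro card_of_mono1) blast
    also have "|{T. T \<subseteq> S \<and> |T| \<le>o \<kappa>}| \<le>o \<mu>"
      using ordLeq_transitive[OF S] ordLeq_transitive[OF ordLess_imp_ordLeq[OF ordLess_ctwo_cexp[OF co\<kappa>]] two\<mu>]
      by (intro card_of_bounded_subsets \<mu> \<mu>\<kappa> co\<kappa>) blast
    finally have "|{\<S>. \<S> \<subseteq> Pow S \<and> |\<S>| \<le>o \<kappa>}| \<le>o \<mu>"
      by (intro card_of_bounded_subsets \<mu> \<mu>\<kappa> co\<kappa>)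
    then have "|{\<S>. \<S> \<subseteq> Pow S \<and> |\<S>| \<le>o \<kappa> \<and> R \<S> \<noteq> {}}| \<le>o \<mu>"
      by (rule ordLeq_transitive[OF card_of_mono1, rotated]) blast
    then show ?thesis
      unfolding F_def using \<B>(2) p
      by (intro card_of_UNION_ordLeq_infinite_Field inf co) (auto simp: R_def)
  qed
  obtain A where A: "|A| \<le>o \<mu>" "\<And>S. S \<subseteq> A \<Longrightarrow> |S| \<le>o \<kappa> \<Longrightarrow> F S \<subseteq> A"
    using exists_closed_set[where F = F, OF \<kappa> \<mu> \<mu>\<kappa>] F by blast
  \<comment> \<open>The closing-off lemma does not say that members of \<open>A\<close> are open or
    nonempty; restricting to those that are loses no member of a \<pi>-base.\<close>
  define A' where "A' = {B\<in>A. openin X B \<and> B \<noteq> {}}"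
  define D where "D = {x\<in>topspace X. \<B> x \<subseteq> A'}"
  have D_dense: "U \<inter> D \<noteq> {}" if U: "openin X U" "U \<noteq> {}" for U
  proof
    assume UD: "U \<inter> D = {}"
    obtain \<V> where \<V>: "\<And>V. V \<in> \<V> \<Longrightarrow> openin X V" "|\<V>| \<le>o ?n" "topspace X \<inter> \<Inter>\<V> \<noteq> {}"
      "topspace X \<inter> (\<Inter>V\<in>\<V>. X closure_of V) \<subseteq> U"
      using nonquasiregularity_degree_family[OF assms U] by metis
    define \<E> where "\<E> V = {B\<in>A'. disjnt B (X closure_of V)}" for V
    have "\<exists>\<M>. \<M> \<subseteq> \<E> V \<and> pairwise disjnt \<M> \<and> (\<forall>B\<in>\<E> V. \<exists>M\<in>\<M>. \<not> disjnt B M)" for V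
      by (rule maximal_disjoint_subfamily) (simp add: \<E>_def A'_def)
    then obtain W where W: "\<And>V. W V \<subseteq> \<E> V" "\<And>V. pairwise disjnt (W V)"
      "\<And>V B. B \<in> \<E> V \<Longrightarrow> \<exists>M\<in>W V. \<not> disjnt B M"
      by metis
    have WE: "B \<in> A'" "openin X B" "B \<noteq> {}" "disjnt B (X closure_of V)" if "B \<in> W V" for B V
      using subsetD[OF W(1) that] by (simp_all add: \<E>_def A'_def)
    have W\<kappa>: "|W V| \<le>o \<kappa>" for V
      using WE W(2)
      by (intro ordLeq_transitive[OF card_of_disjoint_family_le_cellularity c\<kappa>])
    have \<V>\<kappa>: "|\<V>| \<le>o \<kappa>"
      by (rule ordLeq_transitive[OF \<V>(2) n\<kappa>])
    let ?S = "\<Union>(W ` \<V>)" and ?WW = "W ` \<V>"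
    have S: "|?S| \<le>o \<kappa>"
      using \<V>\<kappa> W\<kappa> by (intro card_of_UNION_ordLeq_infinite_Field inf\<kappa> co\<kappa>) auto
    have WW: "|?WW| \<le>o \<kappa>"
      by (rule ordLeq_transitive[OF card_of_image \<V>\<kappa>])
    have "V \<inter> X closure_of \<Union>(W V) = {}" if "V \<in> \<V>" for V
    proof -
      have "V \<subseteq> X closure_of V"
        using \<V>(1)[OF that] by (simp add: closure_of_subset openin_subset)
      then have "V \<inter> \<Union>(W V) = {}"
        using WE(4) unfolding disjnt_def by fast
      then show ?thesis
        using openin_Int_closure_of_eq_empty[OF \<V>(1)[OF that]] by simp
    qed
    then have "topspace X \<inter> \<Inter>\<V> \<subseteq> R ?WW"
      unfolding R_def by blast
    then have R: "R ?WW \<noteq> {}"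
      using \<V>(3) by blast
    define x where "x = p ?WW"
    have x: "x \<in> R ?WW" "x \<in> topspace X"
      using p[OF R] unfolding x_def R_def by auto
    \<comment> \<open>\<open>?WW\<close> is a small family of subsets of \<open>?S\<close>, hence
      one of the families over which \<open>F ?S\<close> ranges.\<close>
    have "\<B> x \<subseteq> F ?S"
      unfolding F_def x_def using WW R by blast
    also have "F ?S \<subseteq> A"
      using WE(1) S unfolding A'_def by (intro A(2)) blast+
    finally have "x \<in> D"
      using \<B>(1)[OF x(2)] x(2) unfolding D_def A'_def local_pi_base_def by blast
    then have "x \<notin> U"
      using UD by blast
    then obtain V where V: "V \<in> \<V>" "x \<notin> X closure_of V"
      using \<V>(4) x(2) by blast
    have "x \<in> X closure_of \<Union>(W V)"
      unfolding in_closure_of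
    proof (intro conjI allI impI x(2))
      fix T assume T: "x \<in> T \<and> openin X T"
      \<comment> \<open>Shrinking \<open>T\<close> makes the \<pi>-base member \<open>B\<close> miss
        the closure of \<open>V\<close>, so \<open>B\<close> lies in \<open>\<E> V\<close> and meets
        a member of \<open>W V\<close> by maximality.\<close>
      then have "openin X (T - X closure_of V)" "x \<in> T - X closure_of V"
        using V(2) by (auto intro: openin_diff)
      then obtain B where B: "B \<in> \<B> x" "B \<subseteq> T - X closure_of V"
        using \<B>(1)[OF x(2)] unfolding local_pi_base_def by meson
      moreover have "B \<in> \<E> V"
        using B \<open>x \<in> D\<close> unfolding D_def \<E>_def disjnt_def by blast
      ultimately obtain M where "M \<in> W V" "\<not> disjnt B M"
        using W(3) by blast
      then show "\<exists>y. y \<in> \<Union>(W V) \<and> y \<in> T"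
        using B(2) unfolding disjnt_def by blast
    qed
    then show False
      using x(1) V(1) unfolding R_def by blast
  qed
  \<comment> \<open>The size of \<open>D\<close> is not controlled. Density of \<open>D\<close> puts
    a member of \<open>A'\<close> inside every nonempty open set, so one point from each member of
    \<open>A'\<close> suffices.\<close>
  let ?E = "(\<lambda>B. SOME y. y \<in> B) ` A'"
  have some: "(SOME y. y \<in> B) \<in> B" if "B \<in> A'" for B
    using that by (simp add: A'_def some_in_eq)
  have "T \<inter> ?E \<noteq> {}" if T: "openin X T" "T \<noteq> {}" for T
  proof -
    obtain x where x: "x \<in> T" "x \<in> topspace X" "\<B> x \<subseteq> A'"
      using D_dense[OF T] unfolding D_def by blast
    then obtain B where "B \<in> \<B> x" "B \<subseteq> T"
      using \<B>(1) T(1) unfolding local_pi_base_def by meson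
    then show ?thesis
      using some x(3) by blast
  qed
  moreover have "?E \<subseteq> topspace X"
    using some openin_subset unfolding A'_def by blast
  ultimately have "dense_subset X ?E"
    unfolding dense_subset_def dense_intersects_open by blast
  then have "topological_density X \<le>o |?E|"
    by (rule topological_density_le)
  also have "|?E| \<le>o |A'|"
    by (rule card_of_image)
  also have "|A'| \<le>o |A|"
    by (rule card_of_mono1) (auto simp: A'_def)
  also note A(1)
  finally show ?thesis
    unfolding \<mu>_def \<kappa>_def .
qed

end
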